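(* Let $\Omega\subset\mathbb H$ be a domain and $f=f_0+\mathbf f\in C^1(\Omega,\mathbb H)$, where $\mathbf f=f_1\mathbf e_1+f_2\mathbf e_2+f_3\mathbf e_3$. Then \begin{align*} \nu[f]=\ &\langle\mathbf x,\mathrm{Grad}f_0+\partial_0\mathbf f+\mathrm{Rot}[\mathbf f]\rangle-(x_2\partial_3f_1-x_3\partial_2f_1)\\ &+(x_1\partial_3f_2-x_3\partial_1f_2)-(x_1\partial_2f_3-x_2\partial_1f_3)\\ &-(\partial_0f_0-\mathrm{Div}[\mathbf f])\,\mathbf x-[\mathbf x,\partial_0\mathbf f+\mathrm{Rot}[\mathbf f]]\\ &-\big((x_1\partial_2f_2-x_2\partial_1f_2)+(x_1\partial_3f_3-x_3\partial_1f_3)\big)\mathbf e_1\\ &+\big((x_1\partial_2f_1-x_2\partial_1f_1)-(x_2\partial_3f_3-x_3\partial_2f_3)\big)\mathbf e_2\\ &+\big((x_1\partial_3f_1-x_3\partial_1f_1)+(x_2\partial_3f_2-x_3\partial_2f_2)\big)\mathbf e_3. \end{align*}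
   Context: $\mathbb H\cong\mathbb R^4$ is the skew field of real quaternions $x=x_0+x_1\mathbf e_1+x_2\mathbf e_2+x_3\mathbf e_3$, with $\mathbf e_k^2=-1$ and $\mathbf e_1\mathbf e_2\mathbf e_3=-1$. The vector part of $x$ is $\mathbf x=x_1\mathbf e_1+x_2\mathbf e_2+x_3\mathbf e_3$, identified with $(x_1,x_2,x_3)\in\mathbb R^3$; $\mathbf x$ also denotes the function $x\mapsto\mathbf x$. Here $f_k$ are the real components of $f$ and $\partial_k=\partial/\partial x_k$. $\nu[f]=-\mathbf x\,\partial_0 f+\sum_{k=1}^3 x_k\partial_k f$. $\langle\cdot,\cdot\rangle$ and $[\cdot,\cdot]$ denote the scalar and vector (cross) product of $\mathbb R^3$. $\mathrm{Grad}f_0=\sum_{k=1}^3\mathbf e_k\partial_kf_0$, $\mathrm{Div}[\mathbf f]=\sum_{k=1}^3\partial_kf_k$, and $\mathrm{Rot}[\mathbf f]=(\partial_2f_3-\partial_3f_2)\mathbf e_1-(\partial_1f_3-\partial_3f_1)\mathbf e_2+(\partial_1f_2-\partial_2f_1)\mathbf e_3$ are the usual gradient, divergence and curl in the variables $x_1,x_2,x_3$. *)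

theory Defs
  imports "HOL-Analysis.Analysis"
begin

section \<open>Real quaternions\<close>

datatype quat = Quat (q0: real) (q1: real) (q2: real) (q3: real)

lemma quat_eq_iff:
  "x = y \<longleftrightarrow> q0 x = q0 y \<and> q1 x = q1 y \<and> q2 x = q2 y \<and> q3 x = q3 y"
  by (cases x; cases y) auto

instantiation quat :: real_vector
begin

definition "0 = Quat 0 0 0 0"
definition "x + y = Quat (q0 x + q0 y) (q1 x + q1 y) (q2 x + q2 y) (q3 x + q3 y)"
definition "- x = Quat (- q0 x) (- q1 x) (- q2 x) (- q3 x)"
definition "x - y = Quat (q0 x - q0 y) (q1 x - q1 y) (q2 x - q2 y) (q3 x - q3 y)"
definition "r *\<^sub>R x = Quat (r * q0 x) (r * q1 x) (r * q2 x) (r * q3 x)"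

instance
  by standard
    (simp_all add: quat_eq_iff zero_quat_def plus_quat_def uminus_quat_def minus_quat_def
      scaleR_quat_def algebra_simps)

end

lemma quat_linear_simps [simp]:
  "q0 0 = 0" "q1 0 = 0" "q2 0 = 0" "q3 0 = 0"
  "q0 (x + y) = q0 x + q0 y" "q1 (x + y) = q1 x + q1 y"
  "q2 (x + y) = q2 x + q2 y" "q3 (x + y) = q3 x + q3 y"
  "q0 (- x) = - q0 x" "q1 (- x) = - q1 x" "q2 (- x) = - q2 x" "q3 (- x) = - q3 x"
  "q0 (x - y) = q0 x - q0 y" "q1 (x - y) = q1 x - q1 y"
  "q2 (x - y) = q2 x - q2 y" "q3 (x - y) = q3 x - q3 y"
  "q0 (r *\<^sub>R x) = r * q0 x" "q1 (r *\<^sub>R x) = r * q1 x"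
  "q2 (r *\<^sub>R x) = r * q2 x" "q3 (r *\<^sub>R x) = r * q3 x"
  by (simp_all add: zero_quat_def plus_quat_def uminus_quat_def minus_quat_def scaleR_quat_def)

instantiation quat :: real_algebra_1
begin

definition "1 = Quat 1 0 0 0"
definition
  "x * y = Quat
     (q0 x * q0 y - q1 x * q1 y - q2 x * q2 y - q3 x * q3 y)
     (q0 x * q1 y + q1 x * q0 y + q2 x * q3 y - q3 x * q2 y)
     (q0 x * q2 y - q1 x * q3 y + q2 x * q0 y + q3 x * q1 y)
     (q0 x * q3 y + q1 x * q2 y - q2 x * q1 y + q3 x * q0 y)"

instance
  by standard (simp_all add: quat_eq_iff one_quat_def times_quat_def algebra_simps)

end

lemma quat_mult_simps [simp]:
  "q0 1 = 1" "q1 1 = 0" "q2 1 = 0" "q3 1 = 0"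
  "q0 (x * y) = q0 x * q0 y - q1 x * q1 y - q2 x * q2 y - q3 x * q3 y"
  "q1 (x * y) = q0 x * q1 y + q1 x * q0 y + q2 x * q3 y - q3 x * q2 y"
  "q2 (x * y) = q0 x * q2 y - q1 x * q3 y + q2 x * q0 y + q3 x * q1 y"
  "q3 (x * y) = q0 x * q3 y + q1 x * q2 y - q2 x * q1 y + q3 x * q0 y"
  by (simp_all add: one_quat_def times_quat_def)

lemma quat_of_real_simps [simp]:
  "q0 (of_real r) = r" "q1 (of_real r) = 0" "q2 (of_real r) = 0" "q3 (of_real r) = 0"
  by (simp_all add: of_real_def)

text \<open>The inner product, and with it the norm and the topology, is that of \<open>\<real>\<^sup>4\<close>.\<close>

instantiation quat :: real_inner
begin

definition "x \<bullet> y = q0 x * q0 y + q1 x * q1 y + q2 x * q2 y + q3 x * q3 y"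
definition "norm (x :: quat) = sqrt (x \<bullet> x)"
definition "dist x (y :: quat) = norm (x - y)"
definition "sgn (x :: quat) = x /\<^sub>R norm x"
definition [code del]:
  "(uniformity :: (quat \<times> quat) filter) = (INF e\<in>{0 <..}. principal {(x, y). dist x y < e})"
definition [code del]:
  "open (U :: quat set) \<longleftrightarrow> (\<forall>x\<in>U. eventually (\<lambda>(x', y). x' = x \<longrightarrow> y \<in> U) uniformity)"

instance
proof
  fix x y z :: quat and r :: real
  show "x \<bullet> y = y \<bullet> x" "(x + y) \<bullet> z = x \<bullet> z + y \<bullet> z" "(r *\<^sub>R x) \<bullet> y = r * (x \<bullet> y)"
    by (simp_all add: inner_quat_def algebra_simps)
  show "0 \<le> x \<bullet> x" by (simp add: inner_quat_def)
  show "x \<bullet> x = 0 \<longleftrightarrow> x = 0"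
    unfolding inner_quat_def quat_eq_iff quat_linear_simps
    by (smt (verit) mult_eq_0_iff zero_le_square)
qed (simp_all only: norm_quat_def dist_quat_def sgn_quat_def uniformity_quat_def open_quat_def)

end

instantiation quat :: real_normed_div_algebra
begin

definition "inverse x = Quat (q0 x) (- q1 x) (- q2 x) (- q3 x) /\<^sub>R (x \<bullet> x)"
definition "x div (y :: quat) = x * inverse y"

instance
proof
  fix x y :: quat
  show "x div y = x * inverse y" by (rule divide_quat_def)
  show "inverse (0 :: quat) = 0" by (simp add: inverse_quat_def quat_eq_iff)
  have *: "x * Quat (q0 x) (- q1 x) (- q2 x) (- q3 x) = (x \<bullet> x) *\<^sub>R 1"
    "Quat (q0 x) (- q1 x) (- q2 x) (- q3 x) * x = (x \<bullet> x) *\<^sub>R 1"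
    by (simp_all add: quat_eq_iff inner_quat_def algebra_simps)
  show "inverse x * x = 1" "x * inverse x = 1" if "x \<noteq> 0"
    using that by (simp_all add: inverse_quat_def *)
  have "(x * y) \<bullet> (x * y) = (x \<bullet> x) * (y \<bullet> y)"
    by (simp add: inner_quat_def algebra_simps)
  then show "norm (x * y) = norm x * norm y"
    by (simp add: norm_quat_def real_sqrt_mult)
qed

end

definition e1 :: quat where "e1 = Quat 0 1 0 0"
definition e2 :: quat where "e2 = Quat 0 0 1 0"
definition e3 :: quat where "e3 = Quat 0 0 0 1"

lemma quat_units:
  "e1 * e1 = -1" "e2 * e2 = -1" "e3 * e3 = -1" "e1 * e2 * e3 = -1"
  by (simp_all add: quat_eq_iff e1_def e2_def e3_def)

lemma quat_expand:
  "x = of_real (q0 x) + q1 x *\<^sub>R e1 + q2 x *\<^sub>R e2 + q3 x *\<^sub>R e3"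
  by (simp add: quat_eq_iff e1_def e2_def e3_def)

instantiation quat :: euclidean_space
begin

definition "Basis = {1, e1, e2, e3}"

instance
proof
  fix x u v :: quat
  show "(Basis :: quat set) \<noteq> {}" "finite (Basis :: quat set)"
    by (simp_all add: Basis_quat_def)
  show "u \<bullet> v = (if u = v then 1 else 0)" if "u \<in> Basis" "v \<in> Basis"
    using that by (auto simp: Basis_quat_def inner_quat_def quat_eq_iff e1_def e2_def e3_def)
  have "x \<bullet> 1 = q0 x" "x \<bullet> e1 = q1 x" "x \<bullet> e2 = q2 x" "x \<bullet> e3 = q3 x"
    by (simp_all add: inner_quat_def e1_def e2_def e3_def)
  then show "(\<forall>u\<in>Basis. x \<bullet> u = 0) \<longleftrightarrow> x = 0"
    by (simp add: Basis_quat_def quat_eq_iff[of x])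
qed

end

text \<open>The identification of purely vectorial quaternions with \<open>\<real>\<^sup>3\<close>.\<close>

definition vpart :: "quat \<Rightarrow> real ^ 3" where
  "vpart x = vector [q1 x, q2 x, q3 x]"

definition of_vec :: "real ^ 3 \<Rightarrow> quat" where
  "of_vec v = (v $ 1) *\<^sub>R e1 + (v $ 2) *\<^sub>R e2 + (v $ 3) *\<^sub>R e3"


section \<open>Differential operators\<close>

definition dir_deriv :: "quat \<Rightarrow> (quat \<Rightarrow> 'a::real_normed_vector) \<Rightarrow> quat \<Rightarrow> 'a" where
  "dir_deriv v f x = vector_derivative (\<lambda>t. f (x + t *\<^sub>R v)) (at 0)"

abbreviation pd0 :: "(quat \<Rightarrow> 'a::real_normed_vector) \<Rightarrow> quat \<Rightarrow> 'a" ("\<partial>\<^sub>0")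
  where "\<partial>\<^sub>0 \<equiv> dir_deriv 1"
abbreviation pd1 :: "(quat \<Rightarrow> 'a::real_normed_vector) \<Rightarrow> quat \<Rightarrow> 'a" ("\<partial>\<^sub>1")
  where "\<partial>\<^sub>1 \<equiv> dir_deriv e1"
abbreviation pd2 :: "(quat \<Rightarrow> 'a::real_normed_vector) \<Rightarrow> quat \<Rightarrow> 'a" ("\<partial>\<^sub>2")
  where "\<partial>\<^sub>2 \<equiv> dir_deriv e2"
abbreviation pd3 :: "(quat \<Rightarrow> 'a::real_normed_vector) \<Rightarrow> quat \<Rightarrow> 'a" ("\<partial>\<^sub>3")
  where "\<partial>\<^sub>3 \<equiv> dir_deriv e3"

text \<open>
  Meant for open \<open>S\<close> (hence \<open>at x\<close> instead of \<open>at x within S\<close>), where it is the class \<open>C\<^sup>1(S)\<close>.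
\<close>

definition C1_on :: "'a::real_normed_vector set \<Rightarrow> ('a \<Rightarrow> 'b::real_normed_vector) \<Rightarrow> bool" where
  "C1_on S f \<longleftrightarrow>
     (\<exists>f' :: 'a \<Rightarrow> 'a \<Rightarrow>\<^sub>L 'b.
        (\<forall>x\<in>S. (f has_derivative blinfun_apply (f' x)) (at x)) \<and> continuous_on S f')"

text \<open>The first product is that of the quaternions, with the vector part on the left.\<close>

definition nu :: "(quat \<Rightarrow> quat) \<Rightarrow> quat \<Rightarrow> quat" ("\<nu>") where
  "\<nu> f x = - (of_vec (vpart x)) * \<partial>\<^sub>0 f x
     + (q1 x *\<^sub>R \<partial>\<^sub>1 f x + q2 x *\<^sub>R \<partial>\<^sub>2 f x + q3 x *\<^sub>R \<partial>\<^sub>3 f x)"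

definition Grad :: "(quat \<Rightarrow> real) \<Rightarrow> quat \<Rightarrow> real ^ 3" where
  "Grad g x = vector [\<partial>\<^sub>1 g x, \<partial>\<^sub>2 g x, \<partial>\<^sub>3 g x]"

definition Div :: "(quat \<Rightarrow> real ^ 3) \<Rightarrow> quat \<Rightarrow> real" where
  "Div F x = \<partial>\<^sub>1 (\<lambda>y. F y $ 1) x + \<partial>\<^sub>2 (\<lambda>y. F y $ 2) x + \<partial>\<^sub>3 (\<lambda>y. F y $ 3) x"

definition Rot :: "(quat \<Rightarrow> real ^ 3) \<Rightarrow> quat \<Rightarrow> real ^ 3" where
  "Rot F x = vector
     [\<partial>\<^sub>2 (\<lambda>y. F y $ 3) x - \<partial>\<^sub>3 (\<lambda>y. F y $ 2) x,
      - (\<partial>\<^sub>1 (\<lambda>y. F y $ 3) x - \<partial>\<^sub>3 (\<lambda>y. F y $ 1) x),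
      \<partial>\<^sub>1 (\<lambda>y. F y $ 2) x - \<partial>\<^sub>2 (\<lambda>y. F y $ 1) x]"

end

theory Submission
  imports Defs
begin

text \<open>
  Expand \<open>\<nu>[f]\<close> in the basis \<open>1, e1, e2, e3\<close>. The only analytic input is that a
  directional derivative commutes with a bounded linear map (lemma
  \<open>dir_deriv_bounded_linear\<close>): applied to the coordinates and to the vector part, it expresses
  every derivative of a component of \<open>f\<close> through the components of the four quaternions
  \<open>\<partial>\<^sub>k f(x)\<close>. What remains is algebra. The product
  \<open>- \<^bold>x \<partial>\<^sub>0 f\<close> has scalar part \<open>\<langle>\<^bold>x, \<partial>\<^sub>0 \<^bold>f\<rangle>\<close> and vector part
  \<open>- \<partial>\<^sub>0 f\<^sub>0 \<^bold>x - [\<^bold>x, \<partial>\<^sub>0 \<^bold>f]\<close>. In the scalar part, the three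
  bracketed terms cancel \<open>\<langle>\<^bold>x, Rot \<^bold>f\<rangle>\<close>. In the vector part, \<open>Div[\<^bold>f] \<^bold>x - [\<^bold>x, Rot \<^bold>f]\<close>
  contains the wanted \<open>\<Sum>\<^sub>k x\<^sub>k \<partial>\<^sub>k \<^bold>f\<close>; its other terms are exactly those
  which the last three lines of the formula remove.
\<close>

text \<open>The chain rule for a linear outer map, whose derivative at every point is the map itself.\<close>

lemma dir_deriv_bounded_linear:
  assumes L: "bounded_linear L" and f: "f differentiable (at x)"
  shows "dir_deriv v (\<lambda>y. L (f y)) x = L (dir_deriv v f x)"
proof -
  from f obtain f' where f': "(f has_derivative f') (at (x + 0 *\<^sub>R v))"
    by (auto simp: differentiable_def)
  have "((\<lambda>t. x + t *\<^sub>R v) has_derivative (\<lambda>t. t *\<^sub>R v)) (at 0)"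
    by (auto intro!: derivative_eq_intros)
  from has_derivative_compose[OF this f']
  have "(\<lambda>t. f (x + t *\<^sub>R v)) differentiable (at 0)"
    by (auto simp: differentiable_def)
  then have "((\<lambda>t. f (x + t *\<^sub>R v)) has_vector_derivative dir_deriv v f x) (at 0)"
    unfolding dir_deriv_def by (simp flip: vector_derivative_works)
  then show ?thesis
    unfolding dir_deriv_def[of v "\<lambda>y. L (f y)"]
    by (rule vector_derivative_at[OF bounded_linear.has_vector_derivative[OF L]])
qed

lemma bounded_linear_components:
  "bounded_linear q0" "bounded_linear q1" "bounded_linear q2" "bounded_linear q3"
  by (simp_all flip: linear_conv_bounded_linear add: linear_iff)

lemma vpart_nth [simp]: "vpart x $ 1 = q1 x" "vpart x $ 2 = q2 x" "vpart x $ 3 = q3 x"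
  by (simp_all add: vpart_def)

lemma bounded_linear_vpart: "bounded_linear vpart"
  by (simp flip: linear_conv_bounded_linear add: linear_iff vec_eq_iff forall_3)

lemma of_vec_simps [simp]:
  "q0 (of_vec v) = 0" "q1 (of_vec v) = v $ 1" "q2 (of_vec v) = v $ 2" "q3 (of_vec v) = v $ 3"
  by (simp_all add: of_vec_def e1_def e2_def e3_def)

theorem corollary3p2:
  fixes \<Omega> :: "quat set" and f :: "quat \<Rightarrow> quat"
  assumes "open \<Omega>" "connected \<Omega>" "\<Omega> \<noteq> {}"
    and "C1_on \<Omega> f"
  shows "let f0 = (\<lambda>y. q0 (f y)); f1 = (\<lambda>y. q1 (f y)); f2 = (\<lambda>y. q2 (f y)); f3 = (\<lambda>y. q3 (f y));
             fv = (\<lambda>y. vpart (f y))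
         in \<forall>x\<in>\<Omega>. let x1 = q1 x; x2 = q2 x; x3 = q3 x; xv = vpart x in
           \<nu> f x =
             of_real
              (xv \<bullet> (Grad f0 x + \<partial>\<^sub>0 fv x + Rot fv x)
               - (x2 * \<partial>\<^sub>3 f1 x - x3 * \<partial>\<^sub>2 f1 x)
               + (x1 * \<partial>\<^sub>3 f2 x - x3 * \<partial>\<^sub>1 f2 x)
               - (x1 * \<partial>\<^sub>2 f3 x - x2 * \<partial>\<^sub>1 f3 x))
             - of_vec ((\<partial>\<^sub>0 f0 x - Div fv x) *\<^sub>R xv)
             - of_vec (cross3 xv (\<partial>\<^sub>0 fv x + Rot fv x))
             - ((x1 * \<partial>\<^sub>2 f2 x - x2 * \<partial>\<^sub>1 f2 x) + (x1 * \<partial>\<^sub>3 f3 x - x3 * \<partial>\<^sub>1 f3 x)) *\<^sub>R e1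
             + ((x1 * \<partial>\<^sub>2 f1 x - x2 * \<partial>\<^sub>1 f1 x) - (x2 * \<partial>\<^sub>3 f3 x - x3 * \<partial>\<^sub>2 f3 x)) *\<^sub>R e2
             + ((x1 * \<partial>\<^sub>3 f1 x - x3 * \<partial>\<^sub>1 f1 x) + (x2 * \<partial>\<^sub>3 f2 x - x3 * \<partial>\<^sub>2 f2 x)) *\<^sub>R e3"
proof -
  have "f differentiable (at x)" if "x \<in> \<Omega>" for x
    using \<open>C1_on \<Omega> f\<close> that unfolding C1_on_def differentiable_def by blast
  note derivs = bounded_linear_components[THEN dir_deriv_bounded_linear, OF this]
    bounded_linear_vpart[THEN dir_deriv_bounded_linear, OF this]
  show ?thesis
    unfolding Let_def
    by (intro ballI)
      (simp add: derivs quat_eq_iff nu_def Grad_def Div_def Rot_def cross3_simps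
        inner_vec_def sum_3 e1_def e2_def e3_def; simp add: algebra_simps)
qed

end
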